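(* Let $w_j=\lambda_j/\sum_{j'\in\mathcal J}\lambda_{j'}$ for $j\in\mathcal J$. Then the optimal value of the $p$-Median problem with weights $w_j$ is a lower bound for the optimal value of the $p$-Hypercube problem: $$\mathrm{OPT}_H\ \ge\ \mathrm{OPT}_M .$$
   Context: $p$-Hypercube model. $\mathcal I=\{1,\dots,N\}$ are candidate sites, $\mathcal J=\{1,\dots,M\}$ subregions, and $p$ units are to be located. Calls from subregion $j$ arrive as a Poisson process with rate $\lambda_j$; a unit located at site $i$ serving subregion $j$ has mean service time $1/\mu_{ij}$; $\tau_i$ is the turnout time at site $i$ and $t_{ij}$ the travel time from $i$ to $j$. A configuration is $x\in\{0,1\}^N$ with $\sum_i x_i=p$; $x_i=1$ means that a unit is located at site $i$ (called unit $i$). For every subregion $j$ there is a predetermined preference list: $\gamma_{jl}$ is the $l$-th preferred unit for $j$ among the $p$ located units, $\eta_{ij}\in\{1,\dots,p\}$ is the rank of unit $i$ in the list of $j$, and $G_{ik}$ is the set of subregions for which unit $i$ is the $k$-th preferred. A call is assigned to the highest-ranked available unit and is lost if no unit is available. For $0\le r\le p-1$ the correction factor is $$Q(p,\bar\rho,r)=\sum_{k=r}^{p-1}\frac{\binom{k}{r}}{\binom{p}{r}}\,\frac{p-k}{p-r}\,\frac{P(k)}{\bar\rho^{\,r}(1-\bar\rho)},$$ where $P(k)=\frac{a^k/k!}{\sum_{n=0}^{p}a^n/n!}$ is the Erlang-loss probability that exactly $k$ of $p$ servers are busy, with $a$ the offered load giving average server utilization $\bar\rho=a(1-P(p))/p$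 (value at $\bar\rho=0$ by continuity). For a configuration $x$, the utilizations $\rho_i=\rho_i(x)$ of the located units solve $$\rho_i=1-\Big(1+\sum_{k=1}^{p}\sum_{j\in G_{ik}}\frac{\lambda_j\,Q(p,\bar\rho,k-1)\prod_{l=1}^{k-1}\rho_{\gamma_{jl}}}{\mu_{ij}}\Big)^{-1},\qquad \bar\rho=\sum_{j\in\mathcal J}\frac{\lambda_j}{p}\sum_{i\in\mathcal I}\frac{q_{ij}(x)}{\mu_{ij}},$$ and $q_{ij}(x)=Q(p,\bar\rho,\eta_{ij}-1)\big(\prod_{l=1}^{\eta_{ij}-1}\rho_{\gamma_{jl}}(x)\big)(1-\rho_i(x))$ if $x_i=1$, $q_{ij}(x)=0$ if $x_i=0$. The $p$-Hypercube problem is $$\mathrm{OPT}_H=\min_{x\in\{0,1\}^N,\ \sum_i x_i=p}\ \sum_{i\in\mathcal I}\sum_{j\in\mathcal J}(\tau_i+t_{ij})\,\frac{\lambda_j}{\sum_{j'\in\mathcal J}\lambda_{j'}}\,\frac{q_{ij}(x)}{\sum_{i'\in\mathcal I}q_{i'j}(x)}.$$ $p$-Median problem with weights $w_j$: $$\mathrm{OPT}_M=\min_{x,y}\ \sum_{i\in\mathcal I}\sum_{j\in\mathcal J}w_j(\tau_i+t_{ij})y_{ij}$$ subject to $\sum_i x_i=p$; $\sum_i y_{ij}=1$ for all $j$; $y_{ij}\le x_i$ for all $i,j$; $x_i,y_{ij}\in\{0,1\}$. *)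

theory Defs
  imports Complex_Main "HOL-Library.FuncSet"
begin

text \<open>Sites are \<open>{1..N}\<close>, subregions are \<open>{1..M}\<close>. Decision vectors are extensional functions
  on the index set, so that each feasible set is finite and \<open>Min\<close> is a genuine minimum.\<close>

definition configs :: "nat \<Rightarrow> nat \<Rightarrow> (nat \<Rightarrow> nat) set" where
  "configs N p = {x \<in> {1..N} \<rightarrow>\<^sub>E {0, 1}. (\<Sum>i=1..N. x i) = p}"

definition located :: "nat \<Rightarrow> (nat \<Rightarrow> nat) \<Rightarrow> nat set" where
  "located N x = {i \<in> {1..N}. x i = 1}"

definition erlang :: "nat \<Rightarrow> real \<Rightarrow> nat \<Rightarrow> real" where
  "erlang p a k = (a ^ k / fact k) / (\<Sum>n=0..p. a ^ n / fact n)"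

definition offered_load :: "nat \<Rightarrow> real \<Rightarrow> real" where
  "offered_load p rb = (THE a. a \<ge> 0 \<and> rb = a * (1 - erlang p a p) / real p)"

text \<open>\<open>Q_formula\<close> is meaningful for \<open>0 < rb < 1\<close>; \<open>Q\<close> extends it to \<open>rb = 0\<close> by continuity.\<close>

definition Q_formula :: "nat \<Rightarrow> real \<Rightarrow> nat \<Rightarrow> real" where
  "Q_formula p rb r =
     (\<Sum>k=r..p-1. real (k choose r) / real (p choose r) * (real (p - k) / real (p - r)) *
        (erlang p (offered_load p rb) k / (rb ^ r * (1 - rb))))"

definition Q :: "nat \<Rightarrow> real \<Rightarrow> nat \<Rightarrow> real" where
  "Q p rb r = (if rb = 0 then Lim (at_right 0) (\<lambda>s. Q_formula p s r) else Q_formula p rb r)"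

text \<open>Below, \<open>g j l\<close> is the \<open>l\<close>-th preferred unit of subregion \<open>j\<close> (\<open>1 \<le> l \<le> p\<close>) among the units
  located by one fixed configuration.\<close>

definition preference_lists :: "nat \<Rightarrow> nat \<Rightarrow> nat \<Rightarrow> (nat \<Rightarrow> nat) \<Rightarrow> (nat \<Rightarrow> nat \<Rightarrow> nat) \<Rightarrow> bool" where
  "preference_lists N M p x g \<longleftrightarrow> (\<forall>j\<in>{1..M}. bij_betw (g j) {1..p} (located N x))"

definition pref_rank :: "nat \<Rightarrow> (nat \<Rightarrow> nat \<Rightarrow> nat) \<Rightarrow> nat \<Rightarrow> nat \<Rightarrow> nat" where
  "pref_rank p g i j = inv_into {1..p} (g j) i"

definition pref_set :: "nat \<Rightarrow> (nat \<Rightarrow> nat \<Rightarrow> nat) \<Rightarrow> nat \<Rightarrow> nat \<Rightarrow> nat set" where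
  "pref_set M g i k = {j \<in> {1..M}. g j k = i}"

definition dispatch_prob ::
  "nat \<Rightarrow> (nat \<Rightarrow> nat) \<Rightarrow> (nat \<Rightarrow> nat \<Rightarrow> nat) \<Rightarrow> (nat \<Rightarrow> real) \<Rightarrow> real \<Rightarrow> nat \<Rightarrow> nat \<Rightarrow> real" where
  "dispatch_prob p x g rho rb i j =
     (if x i = 1
      then Q p rb (pref_rank p g i j - 1) * (\<Prod>l=1..pref_rank p g i j - 1. rho (g j l)) * (1 - rho i)
      else 0)"

text \<open>A utilization is the fraction of time a unit is busy, hence the range condition; the value 1
  is excluded because the system of equations expresses it as 1 minus a reciprocal. The mean \<open>rb\<close>
  is an unknown of the system, coupled to \<open>rho\<close> through \<open>Q\<close>.\<close>

definition utilizations ::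
  "nat \<Rightarrow> nat \<Rightarrow> nat \<Rightarrow> (nat \<Rightarrow> real) \<Rightarrow> (nat \<Rightarrow> nat \<Rightarrow> real) \<Rightarrow> (nat \<Rightarrow> nat) \<Rightarrow> (nat \<Rightarrow> nat \<Rightarrow> nat)
    \<Rightarrow> (nat \<Rightarrow> real) \<Rightarrow> real \<Rightarrow> bool" where
  "utilizations N M p lam mu x g rho rb \<longleftrightarrow>
     (\<forall>i\<in>located N x. 0 \<le> rho i \<and> rho i < 1 \<and>
        rho i = 1 - inverse (1 + (\<Sum>k=1..p. \<Sum>j\<in>pref_set M g i k.
                     lam j * Q p rb (k - 1) * (\<Prod>l=1..k-1. rho (g j l)) / mu i j))) \<and>
     rb = (\<Sum>j=1..M. lam j / real p * (\<Sum>i=1..N. dispatch_prob p x g rho rb i j / mu i j))"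

definition weight :: "nat \<Rightarrow> (nat \<Rightarrow> real) \<Rightarrow> nat \<Rightarrow> real" where
  "weight M lam j = lam j / (\<Sum>j'=1..M. lam j')"

definition hypercube_objective ::
  "nat \<Rightarrow> nat \<Rightarrow> nat \<Rightarrow> (nat \<Rightarrow> real) \<Rightarrow> (nat \<Rightarrow> real) \<Rightarrow> (nat \<Rightarrow> nat \<Rightarrow> real) \<Rightarrow> (nat \<Rightarrow> nat)
    \<Rightarrow> (nat \<Rightarrow> nat \<Rightarrow> nat) \<Rightarrow> (nat \<Rightarrow> real) \<Rightarrow> real \<Rightarrow> real" where
  "hypercube_objective N M p lam tau t x g rho rb =
     (\<Sum>i=1..N. \<Sum>j=1..M. (tau i + t i j) * weight M lam j *
        (dispatch_prob p x g rho rb i j / (\<Sum>i'=1..N. dispatch_prob p x g rho rb i' j)))"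

definition OPT_H ::
  "nat \<Rightarrow> nat \<Rightarrow> nat \<Rightarrow> (nat \<Rightarrow> real) \<Rightarrow> (nat \<Rightarrow> real) \<Rightarrow> (nat \<Rightarrow> nat \<Rightarrow> real)
    \<Rightarrow> ((nat \<Rightarrow> nat) \<Rightarrow> nat \<Rightarrow> nat \<Rightarrow> nat) \<Rightarrow> ((nat \<Rightarrow> nat) \<Rightarrow> nat \<Rightarrow> real) \<Rightarrow> ((nat \<Rightarrow> nat) \<Rightarrow> real)
    \<Rightarrow> real" where
  "OPT_H N M p lam tau t gam rho rb =
     Min ((\<lambda>x. hypercube_objective N M p lam tau t x (gam x) (rho x) (rb x)) ` configs N p)"

definition median_feasible :: "nat \<Rightarrow> nat \<Rightarrow> nat \<Rightarrow> ((nat \<Rightarrow> nat) \<times> (nat \<Rightarrow> nat \<Rightarrow> nat)) set" where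
  "median_feasible N M p =
     {(x, y). x \<in> {1..N} \<rightarrow>\<^sub>E {0, 1} \<and> y \<in> {1..N} \<rightarrow>\<^sub>E ({1..M} \<rightarrow>\<^sub>E {0, 1}) \<and>
        (\<Sum>i=1..N. x i) = p \<and>
        (\<forall>j\<in>{1..M}. (\<Sum>i=1..N. y i j) = 1) \<and>
        (\<forall>i\<in>{1..N}. \<forall>j\<in>{1..M}. y i j \<le> x i)}"

definition OPT_M ::
  "nat \<Rightarrow> nat \<Rightarrow> nat \<Rightarrow> (nat \<Rightarrow> real) \<Rightarrow> (nat \<Rightarrow> real) \<Rightarrow> (nat \<Rightarrow> nat \<Rightarrow> real) \<Rightarrow> real" where
  "OPT_M N M p w tau t =
     Min ((\<lambda>(x, y). \<Sum>i=1..N. \<Sum>j=1..M. w j * (tau i + t i j) * real (y i j)) ` median_feasible N M p)"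

end

(* The equations for the utilizations say that rho i is the workload of unit i, so the mean
   utilization rb is the average of the rho i and lies in [0, 1). The Erlang mean load increases
   strictly from 0 to p, hence the offered load is well defined, Q is nonnegative and
   Q p rb 0 = 1. So the normalised dispatch probabilities of each subregion form a probability
   distribution on the located units, and the expected response time is at least that of the
   fastest located unit, which is the p-median assignment for the same configuration. *)

theory Submission
  imports Defs
begin

section \<open>The Erlang loss distribution and its mean number of busy servers\<close>

lemma erlang_denom_pos:
  fixes a :: real
  assumes "0 \<le> a"
  shows "0 < (\<Sum>n=0..p. a ^ n / fact n)"
proof -
  have "(0::real) < a ^ 0 / fact 0" by simp
  then show ?thesis
    using assms by (intro sum_pos2[of _ 0]) auto
qed

lemma erlang_nonneg: "0 \<le> a \<Longrightarrow> 0 \<le> erlang p a k"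
  unfolding erlang_def using erlang_denom_pos[of a p] by simp

lemma sum_erlang:
  assumes "0 \<le> a"
  shows "(\<Sum>k=0..p. erlang p a k) = 1"
  unfolding erlang_def sum_divide_distrib[symmetric]
  using erlang_denom_pos[OF assms, of p] by simp

lemma erlang_mean:
  assumes "0 \<le> a"
  shows "(\<Sum>k=0..p. real k * erlang p a k) = a * (1 - erlang p a p)"
proof (cases p)
  case 0
  then show ?thesis by (simp add: erlang_def)
next
  case (Suc m)
  \<comment> \<open>Detailed balance between the states k and k + 1. Summed over k < p, it gives
    \<open>a\<close> times the probability that not all servers are busy.\<close>
  have shift: "real (Suc k) * erlang p a (Suc k) = a * erlang p a k" for k
    unfolding erlang_def by (simp add: field_simps del: of_nat_Suc)
  have "(\<Sum>k=0..p. real k * erlang p a k) = (\<Sum>k=0..m. a * erlang p a k)"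
    unfolding Suc sum.atLeast0_atMost_Suc_shift
    using shift by (simp add: Suc del: of_nat_Suc)
  also have "\<dots> = a * ((\<Sum>k=0..p. erlang p a k) - erlang p a p)"
    by (simp add: Suc sum_distrib_left algebra_simps)
  finally show ?thesis
    using sum_erlang[OF assms] by simp
qed

text \<open>The Erlang weights have a monotone likelihood ratio in the load. Cross-multiplying the
  two means and symmetrizing in the two summation indices turns their difference into a double sum
  of nonnegative terms.\<close>

lemma erlang_mean_strict_mono:
  assumes "1 \<le> p" "0 \<le> a" "a < b"
  shows "(\<Sum>k=0..p. real k * erlang p a k) < (\<Sum>k=0..p. real k * erlang p b k)"
proof -
  define u where "u n = a ^ n / fact n" for n
  define v where "v n = b ^ n / fact n" for n
  define A where "A = (\<Sum>n=0..p. u n)"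
  define B where "B = (\<Sum>n=0..p. v n)"
  have A: "0 < A" and B: "0 < B"
    using erlang_denom_pos[of a p] erlang_denom_pos[of b p] assms
    by (auto simp: A_def B_def u_def v_def)
  \<comment> \<open>The cross-multiplied difference of the two means, with the weights
    \<open>u\<close> and \<open>v\<close> not yet normalised.\<close>
  define S where "S = (\<Sum>n=0..p. \<Sum>m=0..p. real n * (v n * u m - u n * v m))"
  have S_eq: "S = (\<Sum>n=0..p. real n * v n) * A - (\<Sum>n=0..p. real n * u n) * B"
    unfolding S_def A_def B_def sum_product
    by (simp add: sum_subtractf algebra_simps)
  \<comment> \<open>The bracket is antisymmetric in n and m, so exchanging the indices only changes
    its sign. Averaging both forms of \<open>S\<close> produces the factor n - m.\<close>
  have S_swap: "S = (\<Sum>n=0..p. \<Sum>m=0..p. - real m * (v n * u m - u n * v m))"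
    unfolding S_def by (subst sum.swap) (simp add: algebra_simps)
  have double: "2 * S = (\<Sum>n=0..p. \<Sum>m=0..p. (real n - real m) * (v n * u m - u n * v m))"
    (is "_ = (\<Sum>n=0..p. \<Sum>m=0..p. ?T n m)")
  proof -
    have "2 * S = S + S" by simp
    also have "\<dots> = (\<Sum>n=0..p. \<Sum>m=0..p. real n * (v n * u m - u n * v m))
        + (\<Sum>n=0..p. \<Sum>m=0..p. - real m * (v n * u m - u n * v m))"
      using S_def S_swap by simp
    also have "\<dots> = (\<Sum>n=0..p. \<Sum>m=0..p. ?T n m)"
      by (simp add: sum.distrib[symmetric] algebra_simps)
    finally show ?thesis .
  qed
  \<comment> \<open>The ratio of \<open>v n\<close> to \<open>u n\<close> is nondecreasing in n,
    stated without division because \<open>u n\<close> vanishes for n > 0 if a = 0.\<close>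
  have ge: "u n * v m \<le> v n * u m" if "m \<le> n" for m n
  proof -
    have "a ^ (n - m) \<le> b ^ (n - m)"
      using assms by (intro power_mono) auto
    then have "a ^ m * b ^ m * a ^ (n - m) \<le> a ^ m * b ^ m * b ^ (n - m)"
      using assms by (intro mult_left_mono) auto
    moreover have "x ^ n = x ^ m * x ^ (n - m)" for x :: real
      using that by (simp flip: power_add)
    ultimately have "a ^ n * b ^ m \<le> b ^ n * a ^ m"
      by (simp add: mult_ac)
    then show ?thesis
      by (simp add: u_def v_def divide_right_mono mult_ac)
  qed
  have T_nonneg: "0 \<le> ?T n m" for n m
  proof (cases "m \<le> n")
    case True
    then show ?thesis using ge[OF True] by simp
  next
    case False
    then show ?thesis
      using ge[of n m] by (intro mult_nonpos_nonpos) (auto simp: mult_ac)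
  qed
  \<comment> \<open>Strictness comes from this single term, whose value is b - a; the index 1 is in
    range because p is at least 1.\<close>
  have "0 < ?T 1 0"
    using assms by (simp add: u_def v_def)
  also have "\<dots> \<le> (\<Sum>m=0..p. ?T 1 m)"
    by (intro member_le_sum[of 0 "{0..p}" "?T 1"] T_nonneg) auto
  also have "\<dots> \<le> (\<Sum>n=0..p. \<Sum>m=0..p. ?T n m)"
    by (rule member_le_sum[of 1 "{0..p}" "\<lambda>n. \<Sum>m=0..p. ?T n m"])
      (use assms(1) T_nonneg in \<open>auto intro!: sum_nonneg\<close>)
  finally have "0 < S" using double by simp
  then have "(\<Sum>n=0..p. real n * u n) / A < (\<Sum>n=0..p. real n * v n) / B"
    using A B S_eq by (simp add: divide_simps mult.commute)
  then show ?thesis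
    by (simp add: erlang_def sum_divide_distrib A_def B_def u_def v_def)
qed

text \<open>Shows that the mean approaches p as the load grows. The carried load
  \<open>a * (1 - erlang p a p)\<close> is at most p, so blocking fails with probability at most p /
  a, and the state k = p alone contributes p times the blocking probability to the mean.\<close>

lemma erlang_mean_ge:
  assumes "0 < a"
  shows "real p - (real p)\<^sup>2 / a \<le> (\<Sum>k=0..p. real k * erlang p a k)"
proof -
  have a: "0 \<le> a" using assms by simp
  let ?E = "\<Sum>k=0..p. real k * erlang p a k"
  have "?E \<le> (\<Sum>k=0..p. real p * erlang p a k)"
    by (intro sum_mono mult_right_mono erlang_nonneg a) auto
  also have "\<dots> = real p"
    by (simp only: sum_distrib_left[symmetric] sum_erlang[OF a] mult_1_right)
  finally have "a * (1 - erlang p a p) \<le> real p"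
    using erlang_mean[OF a] by simp
  then have idle: "1 - erlang p a p \<le> real p / a"
    using assms by (simp add: field_simps)
  have "real p * erlang p a p \<le> ?E"
    by (rule member_le_sum[of p "{0..p}" "\<lambda>k. real k * erlang p a k"])
      (auto intro!: mult_nonneg_nonneg erlang_nonneg a)
  moreover have "real p * (1 - erlang p a p) \<le> real p * (real p / a)"
    by (intro mult_left_mono idle) auto
  ultimately show ?thesis
    by (simp add: algebra_simps power2_eq_square)
qed

section \<open>Offered load and correction factor\<close>

lemma ex1_offered_load:
  assumes "1 \<le> p" "0 \<le> s" "s < 1"
  shows "\<exists>!a. a \<ge> 0 \<and> s = a * (1 - erlang p a p) / real p"
proof -
  define f where "f a = a * (1 - erlang p a p) / real p" for a
  have f_mean: "f a = (\<Sum>k=0..p. real k * erlang p a k) / real p" if "0 \<le> a" for a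
    unfolding f_def using erlang_mean[OF that] by simp
  \<comment> \<open>Chosen so that the lower bound p - p^2 / c of \<open>erlang_mean_ge\<close>
    equals p * s; thus \<open>f\<close> reaches s on the interval from 0 to c.\<close>
  define c where "c = real p / (1 - s)"
  have c: "0 < c" using assms by (simp add: c_def)
  have "s \<le> f c"
  proof -
    have "(real p)\<^sup>2 / c = real p * (1 - s)"
      using assms by (simp add: c_def power2_eq_square)
    then have "real p * s \<le> (\<Sum>k=0..p. real k * erlang p c k)"
      using erlang_mean_ge[OF c, of p] by (simp add: algebra_simps)
    then show ?thesis
      using f_mean[of c] c assms by (simp add: pos_le_divide_eq mult.commute)
  qed
  moreover have "f 0 \<le> s" using assms by (simp add: f_def)
  moreover have "continuous_on {0..c} f"
    unfolding f_def erlang_def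
    using erlang_denom_pos assms(1) by (intro continuous_intros) (auto simp: less_imp_neq[symmetric])
  ultimately obtain a where a: "0 \<le> a" "f a = s"
    using IVT'[of f 0 s c] c by auto
  have "x = y" if "0 \<le> x" "0 \<le> y" "f x = f y" for x y
    using that erlang_mean_strict_mono[OF assms(1), of x y]
      erlang_mean_strict_mono[OF assms(1), of y x] assms(1) f_mean[of x] f_mean[of y]
    by (cases x y rule: linorder_cases) auto
  then show ?thesis
    using a unfolding f_def by metis
qed

lemma offered_load:
  assumes "1 \<le> p" "0 \<le> s" "s < 1"
  shows "0 \<le> offered_load p s"
    and "s = offered_load p s * (1 - erlang p (offered_load p s) p) / real p"
  using theI'[OF ex1_offered_load[OF assms]] unfolding offered_load_def by auto

text \<open>For \<open>r = 0\<close> the correction factor is the mean fraction of idle servers divided by \<open>1 - s\<close>.\<close>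

lemma Q_formula_0:
  assumes "1 \<le> p" "0 \<le> s" "s < 1"
  shows "Q_formula p s 0 = 1"
proof -
  let ?a = "offered_load p s"
  note a = offered_load[OF assms]
  \<comment> \<open>The added term k = p is zero, and over the full range the total mass and the
    mean of the distribution are known.\<close>
  have "(\<Sum>k=0..p-1. real (p - k) * erlang p ?a k) = (\<Sum>k=0..p. real (p - k) * erlang p ?a k)"
    using assms(1) by (cases p) auto
  also have "\<dots> = (\<Sum>k=0..p. real p * erlang p ?a k - real k * erlang p ?a k)"
    by (intro sum.cong) (auto simp: of_nat_diff algebra_simps)
  also have "\<dots> = real p - ?a * (1 - erlang p ?a p)"
    by (simp only: sum_subtractf sum_distrib_left[symmetric] sum_erlang[OF a(1)] erlang_mean[OF a(1)]
        mult_1_right)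
  also have "\<dots> = real p * (1 - s)"
    using a(2) assms(1) by (simp add: field_simps)
  finally have idle: "(\<Sum>k=0..p-1. real (p - k) * erlang p ?a k) = real p * (1 - s)" .
  have "Q_formula p s 0 = (\<Sum>k=0..p-1. real (p - k) * erlang p ?a k) / (real p * (1 - s))"
    unfolding Q_formula_def by (simp add: sum_divide_distrib)
  then show ?thesis
    using idle assms by simp
qed

lemma Q_0:
  assumes "1 \<le> p" "0 \<le> s" "s < 1"
  shows "Q p s 0 = 1"
proof (cases "s = 0")
  case True
  \<comment> \<open>The formula is constantly 1 on the open unit interval, which determines the
    right-hand limit used at zero utilization.\<close>
  have "eventually (\<lambda>s. Q_formula p s 0 = 1) (at_right 0)"
    using Q_formula_0[OF assms(1)] by (auto simp: eventually_at_right[of 0 1] intro!: exI[of _ 1])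
  then have "((\<lambda>s. Q_formula p s 0) \<longlongrightarrow> 1) (at_right 0)"
    by (rule tendsto_eventually)
  then show ?thesis
    unfolding Q_def using True by (simp add: tendsto_Lim)
next
  case False
  then show ?thesis
    unfolding Q_def using Q_formula_0[OF assms] by simp
qed

text \<open>For positive s every summand is nonnegative. The value at s = 0 is a \<open>Lim\<close>,
  whose sign would first require convergence.\<close>

lemma Q_nonneg:
  assumes "1 \<le> p" "0 < s" "s < 1"
  shows "0 \<le> Q p s r"
  unfolding Q_def Q_formula_def
  using assms offered_load(1)[of p s]
  by (auto intro!: sum_nonneg mult_nonneg_nonneg divide_nonneg_nonneg erlang_nonneg)

section \<open>Preference lists, utilizations and dispatch probabilities\<close>

lemma pref_rank_eq_iff:
  assumes "preference_lists N M p x g" "j \<in> {1..M}" "i \<in> located N x" "k \<in> {1..p}"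
  shows "pref_rank p g i j = k \<longleftrightarrow> g j k = i"
proof -
  have "bij_betw (g j) {1..p} (located N x)"
    using assms by (simp add: preference_lists_def)
  then show ?thesis
    unfolding pref_rank_def using assms(3,4)
    by (metis bij_betw_inv_into_left bij_betw_inv_into_right)
qed

lemma pref_rank_in:
  assumes "preference_lists N M p x g" "j \<in> {1..M}" "i \<in> located N x"
  shows "pref_rank p g i j \<in> {1..p}"
proof -
  have "bij_betw (g j) {1..p} (located N x)"
    using assms by (simp add: preference_lists_def)
  then show ?thesis
    unfolding pref_rank_def using assms(3) by (metis bij_betw_imp_surj_on inv_into_into)
qed

text \<open>Each utilization is the workload of its unit, so \<open>rb\<close> is the average utilization.\<close>

lemma utilization_eq_workload:
  assumes pref: "preference_lists N M p x g"
    and util: "utilizations N M p lam mu x g rho rb"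
    and i: "i \<in> located N x"
  shows "rho i = (\<Sum>j=1..M. lam j * dispatch_prob p x g rho rb i j / mu i j)"
proof -
  let ?F = "\<lambda>k j. lam j * Q p rb (k - 1) * (\<Prod>l=1..k-1. rho (g j l)) / mu i j"
  define S where "S = (\<Sum>k=1..p. \<Sum>j\<in>pref_set M g i k. ?F k j)"
  have "rho i < 1" "rho i = 1 - inverse (1 + S)"
    using util i unfolding utilizations_def S_def by auto
  \<comment> \<open>If 1 + S were 0, the convention \<open>inverse 0 = 0\<close> would give
    \<open>rho i = 1\<close>, which the range condition excludes. So the equation can be cleared of
    its reciprocal.\<close>
  then have "inverse (1 + S) = 1 - rho i" "1 + S \<noteq> 0"
    by auto
  then have rho: "rho i = (1 - rho i) * S"
    by (simp add: field_simps)
  have "pref_set M g i k = {j \<in> {1..M}. pref_rank p g i j = k}" if "k \<in> {1..p}" for k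
    using pref_rank_eq_iff[OF pref _ i that] by (auto simp: pref_set_def)
  \<comment> \<open>The sets \<open>pref_set M g i k\<close> partition the subregions by the rank of
    unit i, so the double sum collapses to one sum over all subregions.\<close>
  then have "S = (\<Sum>k=1..p. \<Sum>j\<in>{j \<in> {1..M}. pref_rank p g i j = k}. ?F (pref_rank p g i j) j)"
    unfolding S_def by (intro sum.cong refl) auto
  also have "\<dots> = (\<Sum>j=1..M. ?F (pref_rank p g i j) j)"
    using pref_rank_in[OF pref _ i] by (intro sum.group) auto
  finally have "rho i = (1 - rho i) * (\<Sum>j=1..M. ?F (pref_rank p g i j) j)"
    using rho by simp
  also have "\<dots> = (\<Sum>j=1..M. lam j * dispatch_prob p x g rho rb i j / mu i j)"
    using i by (simp add: sum_distrib_left dispatch_prob_def located_def mult_ac)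
  finally show ?thesis .
qed

lemma sum_located: "(\<Sum>i\<in>located N x. f i) = (\<Sum>i=1..N. if x i = 1 then f i else 0)"
  unfolding located_def by (rule sum.inter_filter) simp

lemma mean_utilization:
  assumes pref: "preference_lists N M p x g"
    and util: "utilizations N M p lam mu x g rho rb"
  shows "rb = (\<Sum>i\<in>located N x. rho i) / real p"
proof -
  have "rb = (\<Sum>j=1..M. lam j / real p * (\<Sum>i=1..N. dispatch_prob p x g rho rb i j / mu i j))"
    using util unfolding utilizations_def by blast
  also have "\<dots> = (\<Sum>i=1..N. \<Sum>j=1..M. lam j * dispatch_prob p x g rho rb i j / mu i j) / real p"
    by (subst sum.swap) (simp add: sum_distrib_left sum_divide_distrib mult_ac)
  also have "(\<Sum>i=1..N. \<Sum>j=1..M. lam j * dispatch_prob p x g rho rb i j / mu i j)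
      = (\<Sum>i\<in>located N x. \<Sum>j=1..M. lam j * dispatch_prob p x g rho rb i j / mu i j)"
    unfolding sum_located by (intro sum.cong refl) (auto simp: dispatch_prob_def)
  also have "\<dots> = (\<Sum>i\<in>located N x. rho i)"
    using utilization_eq_workload[OF pref util] by simp
  finally show ?thesis .
qed

lemma mean_utilization_range:
  assumes "1 \<le> p" "1 \<le> M"
    and pref: "preference_lists N M p x g"
    and util: "utilizations N M p lam mu x g rho rb"
  shows "0 \<le> rb" "rb < 1"
proof -
  have fin: "finite (located N x)" by (simp add: located_def)
  \<comment> \<open>The list of any one subregion counts the located units; subregion 1 exists
    because M is at least 1.\<close>
  have "bij_betw (g 1) {1..p} (located N x)"
    using pref assms(2) by (simp add: preference_lists_def)
  then have card: "card (located N x) = p"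
    by (simp add: bij_betw_same_card[symmetric])
  have rho: "0 \<le> rho i" "rho i < 1" if "i \<in> located N x" for i
    using util that unfolding utilizations_def by auto
  show "0 \<le> rb"
    unfolding mean_utilization[OF pref util] using rho by (simp add: sum_nonneg)
  have "(\<Sum>i\<in>located N x. rho i) < (\<Sum>i\<in>located N x. 1)"
    using fin card rho assms(1) by (intro sum_strict_mono) auto
  then show "rb < 1"
    unfolding mean_utilization[OF pref util] using card assms(1) by simp
qed

text \<open>At rank 1 the product is empty and the correction factor is 1. The resulting positive
  value later makes the normalising sum of each subregion positive.\<close>

lemma dispatch_prob_first:
  assumes "1 \<le> p" "j \<in> {1..M}"
    and pref: "preference_lists N M p x g"
    and util: "utilizations N M p lam mu x g rho rb"
  shows "g j 1 \<in> located N x"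
    and "dispatch_prob p x g rho rb (g j 1) j = 1 - rho (g j 1)"
proof -
  have "bij_betw (g j) {1..p} (located N x)"
    using pref assms(2) by (simp add: preference_lists_def)
  then show first: "g j 1 \<in> located N x"
    using assms(1) bij_betwE[of "g j"] by simp
  have "pref_rank p g (g j 1) j = 1"
    using pref_rank_eq_iff[OF pref assms(2) first, of 1] assms(1) by simp
  moreover have "Q p rb 0 = 1"
    using Q_0[OF assms(1)] mean_utilization_range[OF assms(1) _ pref util] assms(2) by simp
  ultimately show "dispatch_prob p x g rho rb (g j 1) j = 1 - rho (g j 1)"
    using first by (simp add: dispatch_prob_def located_def)
qed

text \<open>If the mean utilization were 0, all utilizations would vanish, so that only first choices
  have a nonzero dispatch probability; the value of \<open>Q\<close> at \<open>rb = 0\<close> is thus needed for \<open>r = 0\<close>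
  only.\<close>

lemma mean_utilization_pos:
  assumes "1 \<le> p"
    and lam: "\<And>j. j \<in> {1..M} \<Longrightarrow> 0 \<le> lam j" "0 < (\<Sum>j=1..M. lam j)"
    and mu: "\<And>i j. i \<in> {1..N} \<Longrightarrow> j \<in> {1..M} \<Longrightarrow> 0 < mu i j"
    and pref: "preference_lists N M p x g"
    and util: "utilizations N M p lam mu x g rho rb"
  shows "0 < rb"
proof (rule ccontr)
  assume "\<not> 0 < rb"
  have M: "1 \<le> M" using lam(2) by (cases M) auto
  have rho: "0 \<le> rho i" "rho i < 1" if "i \<in> located N x" for i
    using util that unfolding utilizations_def by auto
  have fin: "finite (located N x)" by (simp add: located_def)
  have "rb = 0"
    using mean_utilization_range[OF assms(1) M pref util] \<open>\<not> 0 < rb\<close> by simp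
  then have "(\<Sum>i\<in>located N x. rho i) = 0"
    using mean_utilization[OF pref util] assms(1) by simp
  then have rho0: "rho i = 0" if "i \<in> located N x" for i
    using that fin rho by (simp add: sum_nonneg_eq_0_iff)
  \<comment> \<open>A subregion with positive demand sends calls to its first choice
    \<open>i\<close>, giving that unit a positive workload. This contradicts
    \<open>rho i = 0\<close>, provided the other contributions to the workload are
    nonnegative.\<close>
  obtain j where j: "j \<in> {1..M}" "0 < lam j"
    using lam by (metis less_eq_real_def sum.neutral less_irrefl)
  define i where "i = g j 1"
  note first = dispatch_prob_first[OF assms(1) j(1) pref util, folded i_def]
  have in_N: "i \<in> {1..N}" using first(1) by (simp add: located_def)
  have nonneg: "0 \<le> dispatch_prob p x g rho rb i j'" if "j' \<in> {1..M}" for j'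
  proof (cases "pref_rank p g i j' = 1")
    case True
    then have "g j' 1 = i"
      using pref_rank_eq_iff[OF pref that first(1), of 1] assms(1) by simp
    then show ?thesis
      using dispatch_prob_first(2)[OF assms(1) that pref util] rho0[OF first(1)] by simp
  next
    case False
    \<comment> \<open>From rank 2 on, the product contains the zero utilization of the first
      choice.\<close>
    then have "1 \<in> {1..pref_rank p g i j' - 1}"
      using pref_rank_in[OF pref that first(1)] by auto
    moreover have "rho (g j' 1) = 0"
      using rho0 dispatch_prob_first(1)[OF assms(1) that pref util] by simp
    ultimately have "(\<Prod>l=1..pref_rank p g i j' - 1. rho (g j' l)) = 0"
      by (meson finite_atLeastAtMost prod_zero)
    then show ?thesis by (simp only: dispatch_prob_def mult_zero_left mult_zero_right if_cancel order.refl)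
  qed
  have "0 < lam j * dispatch_prob p x g rho rb i j / mu i j"
    using j first(2) rho(2)[OF first(1)] mu[OF in_N j(1)] by simp
  also have "\<dots> \<le> (\<Sum>j=1..M. lam j * dispatch_prob p x g rho rb i j / mu i j)"
    using j(1) nonneg lam(1) mu[OF in_N]
    by (intro member_le_sum[of j "{1..M}" "\<lambda>j. lam j * dispatch_prob p x g rho rb i j / mu i j"])
      (auto intro!: divide_nonneg_pos)
  also have "\<dots> = rho i"
    using utilization_eq_workload[OF pref util first(1)] by simp
  finally show False using rho0[OF first(1)] by simp
qed

lemma dispatch_prob_nonneg:
  assumes "1 \<le> p" "0 < rb" "rb < 1" "j \<in> {1..M}" "i \<in> {1..N}"
    and pref: "preference_lists N M p x g"
    and util: "utilizations N M p lam mu x g rho rb"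
  shows "0 \<le> dispatch_prob p x g rho rb i j"
proof (cases "i \<in> located N x")
  case True
  have rho: "0 \<le> rho i" "rho i < 1" if "i \<in> located N x" for i
    using util that unfolding utilizations_def by auto
  have bij: "bij_betw (g j) {1..p} (located N x)"
    using pref assms(4) by (simp add: preference_lists_def)
  have "0 \<le> (\<Prod>l=1..pref_rank p g i j - 1. rho (g j l))"
  proof (rule prod_nonneg)
    fix l assume "l \<in> {1..pref_rank p g i j - 1}"
    then have "l \<in> {1..p}"
      using pref_rank_in[OF pref assms(4) True] by auto
    then show "0 \<le> rho (g j l)"
      using rho(1) bij_betwE[OF bij] by blast
  qed
  then show ?thesis
    using rho(2)[OF True] Q_nonneg[OF assms(1-3)] by (simp add: dispatch_prob_def)
next
  case False
  then show ?thesis using assms(5) by (simp add: located_def dispatch_prob_def)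
qed

section \<open>Feasible sets and comparison of the two optima\<close>

lemma finite_configs: "finite (configs N p)"
proof (rule finite_subset)
  show "configs N p \<subseteq> {1..N} \<rightarrow>\<^sub>E {0, 1}" unfolding configs_def by auto
  show "finite ({1..N} \<rightarrow>\<^sub>E {0, 1::nat})" by (intro finite_PiE) auto
qed

text \<open>\<open>Min\<close> of an empty set is unspecified, so bounding \<open>OPT_H\<close> from
  below requires a configuration; occupying the first p sites gives one.\<close>

lemma configs_nonempty:
  assumes "p \<le> N"
  shows "configs N p \<noteq> {}"
proof -
  define x :: "nat \<Rightarrow> nat" where
    "x = (\<lambda>i. if i \<in> {1..N} then (if i \<le> p then 1 else 0) else undefined)"
  have "(\<Sum>i=1..N. x i) = (\<Sum>i\<in>{i \<in> {1..N}. i \<le> p}. 1)"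
    by (simp only: sum.inter_filter finite_atLeastAtMost) (auto simp: x_def intro!: sum.cong)
  also have "{i \<in> {1..N}. i \<le> p} = {1..p}" using assms by auto
  finally have "x \<in> configs N p" by (auto simp: configs_def x_def PiE_iff extensional_def)
  then show ?thesis by blast
qed

lemma finite_median_feasible: "finite (median_feasible N M p)"
proof (rule finite_subset)
  show "median_feasible N M p \<subseteq>
      ({1..N} \<rightarrow>\<^sub>E {0, 1}) \<times> ({1..N} \<rightarrow>\<^sub>E ({1..M} \<rightarrow>\<^sub>E {0, 1}))"
    unfolding median_feasible_def by auto
  show "finite (({1..N} \<rightarrow>\<^sub>E {0, 1::nat}) \<times> ({1..N} \<rightarrow>\<^sub>E ({1..M} \<rightarrow>\<^sub>E {0, 1::nat})))"
    by (intro finite_cartesian_product finite_PiE) auto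
qed

text \<open>Any selection of one located unit per subregion is a feasible assignment, with
  \<open>y\<close> its indicator matrix.\<close>

lemma OPT_M_le_assignment:
  assumes x: "x \<in> configs N p"
    and s: "\<And>j. j \<in> {1..M} \<Longrightarrow> s j \<in> located N x"
  shows "OPT_M N M p w tau t \<le> (\<Sum>j=1..M. w j * (tau (s j) + t (s j) j))"
proof -
  define y :: "nat \<Rightarrow> nat \<Rightarrow> nat" where
    "y = (\<lambda>i\<in>{1..N}. \<lambda>j\<in>{1..M}. if i = s j then 1 else 0)"
  have y: "y i j = (if i = s j then 1 else 0)" if "i \<in> {1..N}" "j \<in> {1..M}" for i j
    using that by (simp add: y_def)
  have sN: "s j \<in> {1..N}" "x (s j) = 1" if "j \<in> {1..M}" for j
    using s[OF that] by (auto simp: located_def)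
  have "(\<Sum>i=1..N. y i j) = 1" if "j \<in> {1..M}" for j
    using sN[OF that] that by (simp add: y sum.delta')
  moreover have "y i j \<le> x i" if "i \<in> {1..N}" "j \<in> {1..M}" for i j
    using sN[OF that(2)] y[OF that] by auto
  moreover have "y \<in> {1..N} \<rightarrow>\<^sub>E ({1..M} \<rightarrow>\<^sub>E {0, 1})"
    by (auto simp: y_def)
  ultimately have "(x, y) \<in> median_feasible N M p"
    using x by (simp add: median_feasible_def configs_def)
  then have "OPT_M N M p w tau t \<le> (\<Sum>i=1..N. \<Sum>j=1..M. w j * (tau i + t i j) * real (y i j))"
    unfolding OPT_M_def by (intro Min_le finite_imageI finite_median_feasible) force
  also have "\<dots> = (\<Sum>j=1..M. \<Sum>i=1..N. w j * (tau i + t i j) * real (y i j))"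
    by (rule sum.swap)
  also have "\<dots> = (\<Sum>j=1..M. w j * (tau (s j) + t (s j) j))"
  proof (rule sum.cong[OF refl])
    fix j assume j: "j \<in> {1..M}"
    have "(\<Sum>i=1..N. w j * (tau i + t i j) * real (y i j))
        = (\<Sum>i=1..N. if i = s j then w j * (tau i + t i j) else 0)"
      using j by (intro sum.cong refl) (auto simp: y)
    then show "(\<Sum>i=1..N. w j * (tau i + t i j) * real (y i j)) = w j * (tau (s j) + t (s j) j)"
      using sN(1)[OF j] by (simp add: sum.delta)
  qed
  finally show ?thesis .
qed

text \<open>The bound on \<open>c\<close> is demanded only where the weight is nonzero: a site
  without a unit may be faster than every located unit, but has dispatch probability zero.\<close>

lemma weighted_mean_ge:
  fixes c q :: "'a \<Rightarrow> real"
  assumes "finite A" "\<And>i. i \<in> A \<Longrightarrow> 0 \<le> q i" "0 < sum q A" "\<And>i. i \<in> A \<Longrightarrow> q i \<noteq> 0 \<Longrightarrow> m \<le> c i"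
  shows "m \<le> (\<Sum>i\<in>A. c i * (q i / sum q A))"
proof -
  have "m * sum q A \<le> (\<Sum>i\<in>A. c i * q i)"
    unfolding sum_distrib_left
  proof (rule sum_mono)
    fix i assume "i \<in> A"
    then show "m * q i \<le> c i * q i"
      using assms(2,4) by (cases "q i = 0") (auto intro: mult_right_mono)
  qed
  then show ?thesis
    using assms(3) by (simp add: sum_divide_distrib[symmetric] field_simps)
qed

lemma OPT_M_le_hypercube_objective:
  assumes p: "1 \<le> p" and x: "x \<in> configs N p"
    and lam: "\<And>j. j \<in> {1..M} \<Longrightarrow> 0 \<le> lam j" "0 < (\<Sum>j=1..M. lam j)"
    and mu: "\<And>i j. i \<in> {1..N} \<Longrightarrow> j \<in> {1..M} \<Longrightarrow> 0 < mu i j"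
    and pref: "preference_lists N M p x g"
    and util: "utilizations N M p lam mu x g rho rb"
  shows "OPT_M N M p (weight M lam) tau t \<le> hypercube_objective N M p lam tau t x g rho rb"
proof -
  have M: "1 \<le> M" using lam(2) by (cases M) auto
  have rb: "0 < rb" "rb < 1"
    using mean_utilization_pos[OF p lam mu pref util] mean_utilization_range[OF p M pref util] by auto
  let ?q = "dispatch_prob p x g rho rb"
  define s where "s j = arg_min_on (\<lambda>i. tau i + t i j) (located N x)" for j
  have fin: "finite (located N x)" by (simp add: located_def)
  have s: "s j \<in> located N x" if "j \<in> {1..M}" for j
    unfolding s_def using dispatch_prob_first(1)[OF p that pref util]
    by (intro arg_min_if_finite fin) auto
  have s_le: "tau (s j) + t (s j) j \<le> tau i + t i j" if "i \<in> located N x" for i j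
    unfolding s_def using that by (intro arg_min_least[OF fin, of i "\<lambda>i. tau i + t i j"]) auto
  have "OPT_M N M p (weight M lam) tau t \<le> (\<Sum>j=1..M. weight M lam j * (tau (s j) + t (s j) j))"
    by (rule OPT_M_le_assignment[OF x s])
  \<comment> \<open>The comparison is made separately for each subregion: the time of its fastest
    located unit against a weighted mean over all sites.\<close>
  also have "\<dots> \<le> (\<Sum>j=1..M. weight M lam j *
      (\<Sum>i=1..N. (tau i + t i j) * (?q i j / (\<Sum>i'=1..N. ?q i' j))))"
  proof (intro sum_mono mult_left_mono weighted_mean_ge)
    fix j assume j: "j \<in> {1..M}"
    show "0 \<le> weight M lam j" using lam j by (simp add: weight_def)
    show "0 \<le> ?q i j" if "i \<in> {1..N}" for i
      using dispatch_prob_nonneg[OF p rb j that pref util] .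
    note first = dispatch_prob_first[OF p j pref util]
    have "rho (g j 1) < 1" using util first(1) unfolding utilizations_def by auto
    then show "0 < (\<Sum>i=1..N. ?q i j)"
      using first dispatch_prob_nonneg[OF p rb j _ pref util]
      by (intro sum_pos2[of _ "g j 1"]) (auto simp: located_def)
    show "tau (s j) + t (s j) j \<le> tau i + t i j" if "i \<in> {1..N}" "?q i j \<noteq> 0" for i
      using that by (intro s_le) (auto simp: located_def dispatch_prob_def split: if_splits)
  qed simp
  also have "\<dots> = hypercube_objective N M p lam tau t x g rho rb"
    unfolding hypercube_objective_def
    by (simp only: sum_distrib_left, subst sum.swap) (simp only: mult_ac)
  finally show ?thesis .
qed

theorem theorem2:
  fixes N M p :: nat
    and lam tau :: "nat \<Rightarrow> real"
    and mu t :: "nat \<Rightarrow> nat \<Rightarrow> real"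
    and gam :: "(nat \<Rightarrow> nat) \<Rightarrow> nat \<Rightarrow> nat \<Rightarrow> nat"
    and rho :: "(nat \<Rightarrow> nat) \<Rightarrow> nat \<Rightarrow> real"
    and rb :: "(nat \<Rightarrow> nat) \<Rightarrow> real"
  assumes "1 \<le> p" and "p \<le> N"
    and "\<And>j. j \<in> {1..M} \<Longrightarrow> 0 \<le> lam j"
    and "0 < (\<Sum>j=1..M. lam j)"
    and "\<And>i j. i \<in> {1..N} \<Longrightarrow> j \<in> {1..M} \<Longrightarrow> 0 < mu i j"
    and "\<And>x. x \<in> configs N p \<Longrightarrow> preference_lists N M p x (gam x)"
    and "\<And>x. x \<in> configs N p \<Longrightarrow> utilizations N M p lam mu x (gam x) (rho x) (rb x)"
  shows "OPT_H N M p lam tau t gam rho rb \<ge> OPT_M N M p (weight M lam) tau t"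
proof -
  have "OPT_M N M p (weight M lam) tau t
      \<le> hypercube_objective N M p lam tau t x (gam x) (rho x) (rb x)" if "x \<in> configs N p" for x
    by (rule OPT_M_le_hypercube_objective[OF assms(1) that assms(3-5) assms(6,7)[OF that]])
  then show ?thesis
    unfolding OPT_H_def
    using finite_configs configs_nonempty[OF assms(2)] by (intro Min.boundedI) auto
qed

end
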